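(* A binary function is stable if and only if it has no minor isomorphic to $f_{-1}$.
   Context: A binary function on a finite ground set $E$ is a function $f\colon 2^E\to\mathbb{R}$ with $f(\emptyset)=1$. For $X\subseteq E$, the contraction $f/X\colon 2^{E\setminus X}\to\mathbb{R}$ is $f/X(Y)=f(Y)$. The deletion $f\setminus X\colon 2^{E\setminus X}\to\mathbb{R}$ is $f\setminus X(Y)=\frac{\sum_{Z\subseteq X} f(Y\cup Z)}{\sum_{Z\subseteq X} f(Z)}$, which is well defined exactly when the denominator is nonzero. For disjoint $X,Y\subseteq E$, $f/X\setminus Y$ denotes $(f/X)\setminus Y$. A minor of $f$ is a well-defined binary function of the form $f/X\setminus Y$ for disjoint $X,Y\subseteq E$. The binary function $f$ is stable if $f/X\setminus Y$ is well defined for all disjoint $X,Y\subseteq E$. Two binary functions $f$ on $E$ and $f'$ on $E'$ are isomorphic if there is a bijection $\phi\colon E\to E'$ with $f(X)=f'(\phi(X))$ for all $X\subseteq E$. For $\alpha\in\mathbb{R}$, $f_\alpha$ denotes the binary function on a one-element ground set $E$ with $f_\alpha(E)=\alpha$ (unique up to isomorphism). *)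

theory Defs
  imports Complex_Main "HOL-Library.FuncSet"
begin

text \<open>A real-valued function on the subsets of a ground set. Functions with domain \<open>2\<^sup>E\<close> are
  represented as total functions that are \<open>undefined\<close> outside \<open>Pow E\<close>, so that equality of records
  is equality of the functions represented.\<close>

record 'a set_fun =
  ground :: "'a set"
  val :: "'a set \<Rightarrow> real"

definition binary_function :: "'a set_fun \<Rightarrow> bool" where
  "binary_function f \<longleftrightarrow>
     finite (ground f) \<and> val f \<in> extensional (Pow (ground f)) \<and> val f {} = 1"

definition contract :: "'a set_fun \<Rightarrow> 'a set \<Rightarrow> 'a set_fun" where
  "contract f X = \<lparr>ground = ground f - X, val = (\<lambda>Y \<in> Pow (ground f - X). val f Y)\<rparr>"

definition delete :: "'a set_fun \<Rightarrow> 'a set \<Rightarrow> 'a set_fun" where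
  "delete f X = \<lparr>ground = ground f - X,
     val = (\<lambda>Y \<in> Pow (ground f - X).
              (\<Sum>Z \<in> Pow X. val f (Y \<union> Z)) / (\<Sum>Z \<in> Pow X. val f Z))\<rparr>"

text \<open>Since \<open>x / 0 = 0\<close>, \<open>delete f X\<close> is meaningful only under the following condition.\<close>

definition delete_well_defined :: "'a set_fun \<Rightarrow> 'a set \<Rightarrow> bool" where
  "delete_well_defined f X \<longleftrightarrow> (\<Sum>Z \<in> Pow X. val f Z) \<noteq> 0"

definition minor_of :: "'a set_fun \<Rightarrow> 'a set_fun \<Rightarrow> bool" where
  "minor_of g f \<longleftrightarrow> (\<exists>X Y. X \<subseteq> ground f \<and> Y \<subseteq> ground f \<and> X \<inter> Y = {} \<and>
     delete_well_defined (contract f X) Y \<and> g = delete (contract f X) Y)"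

definition stable_function :: "'a set_fun \<Rightarrow> bool" where
  "stable_function f \<longleftrightarrow> (\<forall>X Y. X \<subseteq> ground f \<longrightarrow> Y \<subseteq> ground f \<longrightarrow> X \<inter> Y = {} \<longrightarrow>
     delete_well_defined (contract f X) Y)"

definition isomorphic :: "'a set_fun \<Rightarrow> 'b set_fun \<Rightarrow> bool" where
  "isomorphic f g \<longleftrightarrow> (\<exists>\<phi>. bij_betw \<phi> (ground f) (ground g) \<and>
     (\<forall>X. X \<subseteq> ground f \<longrightarrow> val f X = val g (\<phi> ` X)))"

definition f_alpha :: "real \<Rightarrow> unit set_fun" where
  "f_alpha \<alpha> = \<lparr>ground = {()}, val = (\<lambda>X. if X = {} then 1 else \<alpha>)\<rparr>"

lemma binary_function_contract:
  "binary_function f \<Longrightarrow> binary_function (contract f X)"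
  by (simp add: binary_function_def contract_def)

lemma binary_function_delete:
  "binary_function f \<Longrightarrow> delete_well_defined f X \<Longrightarrow> binary_function (delete f X)"
  by (simp add: binary_function_def delete_def delete_well_defined_def)

lemma binary_function_f_alpha: "binary_function (f_alpha \<alpha>)"
proof -
  have "Pow {()} = UNIV"
    by auto
  then show ?thesis
    by (simp add: binary_function_def f_alpha_def extensional_def)
qed

lemma isomorphic_f_alpha_iff:
  assumes "binary_function g"
  shows "isomorphic g (f_alpha \<alpha>) \<longleftrightarrow> card (ground g) = 1 \<and> val g (ground g) = \<alpha>"
proof
  assume "isomorphic g (f_alpha \<alpha>)"
  then obtain \<phi> where bij: "bij_betw \<phi> (ground g) {()}"
    and val: "\<And>X. X \<subseteq> ground g \<Longrightarrow> val g X = val (f_alpha \<alpha>) (\<phi> ` X)"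
    by (auto simp: isomorphic_def f_alpha_def)
  have "card (ground g) = 1"
    using bij_betw_same_card[OF bij] by simp
  moreover from this have "ground g \<noteq> {}"
    by auto
  ultimately show "card (ground g) = 1 \<and> val g (ground g) = \<alpha>"
    using val[of "ground g"] by (simp add: f_alpha_def)
next
  assume g: "card (ground g) = 1 \<and> val g (ground g) = \<alpha>"
  then obtain e where e: "ground g = {e}"
    by (auto simp: card_1_singleton_iff)
  have "bij_betw (\<lambda>_. ()) (ground g) (ground (f_alpha \<alpha>))"
    by (simp add: e f_alpha_def bij_betw_def)
  moreover have "val g X = val (f_alpha \<alpha>) ((\<lambda>_. ()) ` X)" if "X \<subseteq> ground g" for X
    using that g assms by (auto simp: e f_alpha_def binary_function_def subset_singleton_iff)
  ultimately show "isomorphic g (f_alpha \<alpha>)"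
    unfolding isomorphic_def by blast
qed

end

theory Submission
  imports Defs
begin

text \<open>Write \<open>S Y\<close> for the sum of \<open>f\<close> over all subsets of \<open>Y\<close>. Stability says that \<open>S\<close> vanishes
  nowhere, and a one-element minor \<open>f / X \ Y\<close> on \<open>{e}\<close> takes the value \<open>S (Y \<union> {e}) / S Y - 1\<close> at
  \<open>{e}\<close>, which is \<open>-1\<close> exactly when \<open>S (Y \<union> {e}) = 0\<close>. If \<open>S W = 0\<close>, then building up
  \<open>W\<close> one element at a time from \<open>S {} = 1\<close> passes from some \<open>S Y \<noteq> 0\<close> to \<open>S (Y \<union> {e}) = 0\<close>.\<close>

definition subset_sum :: "'a set_fun \<Rightarrow> 'a set \<Rightarrow> real" where
  "subset_sum f Y = (\<Sum>Z \<in> Pow Y. val f Z)"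

text \<open>The subsets of \<open>insert e Y\<close> split into those that avoid \<open>e\<close>
  and those that contain it; the latter are the sets \<open>insert e Z\<close> with \<open>Z\<close>
  a subset of \<open>Y\<close>.\<close>

lemma subset_sum_insert:
  assumes "finite Y" "e \<notin> Y"
  shows "subset_sum f (insert e Y) = subset_sum f Y + (\<Sum>Z \<in> Pow Y. val f (insert e Z))"
proof -
  have "inj_on (insert e) (Pow Y)"
    using assms(2) by (auto simp: inj_on_def)
  moreover have "Pow Y \<inter> insert e ` Pow Y = {}"
    using assms(2) by auto
  ultimately show ?thesis
    using assms(1)
    by (simp add: subset_sum_def Pow_insert sum.union_disjoint sum.reindex)
qed

text \<open>Contraction only restricts the domain, and disjointness keeps every subset of
  \<open>Y\<close> inside it, so the denominator of the deletion does not depend on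
  \<open>X\<close>.\<close>

lemma delete_well_defined_contract_iff:
  assumes "Y \<subseteq> ground f" "X \<inter> Y = {}"
  shows "delete_well_defined (contract f X) Y \<longleftrightarrow> subset_sum f Y \<noteq> 0"
proof -
  have "(\<Sum>Z \<in> Pow Y. val (contract f X) Z) = (\<Sum>Z \<in> Pow Y. val f Z)"
    using assms by (intro sum.cong) (auto simp: contract_def)
  then show ?thesis
    by (simp add: delete_well_defined_def subset_sum_def)
qed

lemma stable_function_iff:
  "stable_function f \<longleftrightarrow> (\<forall>Y \<subseteq> ground f. subset_sum f Y \<noteq> 0)"
proof
  assume stable: "stable_function f"
  show "\<forall>Y \<subseteq> ground f. subset_sum f Y \<noteq> 0"
  proof (intro allI impI)
    fix Y assume "Y \<subseteq> ground f"
    with stable show "subset_sum f Y \<noteq> 0"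
      using delete_well_defined_contract_iff[of Y f "{}"] by (simp add: stable_function_def)
  qed
qed (simp add: stable_function_def delete_well_defined_contract_iff)

text \<open>The numerator of the deletion at \<open>{e}\<close> sums \<open>f\<close> over the
  subsets of \<open>insert e Y\<close> that contain \<open>e\<close>. By
  \<open>subset_sum_insert\<close> this is a difference of two subset sums, whence the
  \<open>- 1\<close>.\<close>

lemma val_singleton_minor:
  assumes "finite Y" "Y \<subseteq> ground f" "X \<inter> Y = {}" "ground f - X - Y = {e}"
    and "subset_sum f Y \<noteq> 0"
  shows "val (delete (contract f X) Y) {e} = subset_sum f (insert e Y) / subset_sum f Y - 1"
proof -
  have e: "e \<in> ground f" "e \<notin> X" "e \<notin> Y"
    using assms(4) by auto
  \<comment> \<open>Both sets lie in the domain of the contraction, so neither value is the default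
    \<open>undefined\<close>.\<close>
  have sub: "insert e Z \<subseteq> ground f - X" "Z \<subseteq> ground f - X" if "Z \<subseteq> Y" for Z
    using that assms(2,3) e by auto
  have "val (delete (contract f X) Y) {e} =
      (\<Sum>Z \<in> Pow Y. val (contract f X) (insert e Z)) / (\<Sum>Z \<in> Pow Y. val (contract f X) Z)"
    using assms(4) by (simp add: delete_def contract_def cong: if_cong)
  also have "\<dots> = (\<Sum>Z \<in> Pow Y. val f (insert e Z)) / subset_sum f Y"
    unfolding subset_sum_def
    by (intro arg_cong2[where f = divide] sum.cong) (use sub in \<open>auto simp: contract_def\<close>)
  also have "\<dots> = subset_sum f (insert e Y) / subset_sum f Y - 1"
    using assms(5) by (simp add: subset_sum_insert[OF assms(1) e(3)] field_simps)
  finally show ?thesis .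
qed

text \<open>One-element minors correspond to pairs of a deleted set \<open>Y\<close> and a surviving
  element \<open>e\<close>, since the contracted set must then be everything else.\<close>

lemma minor_isomorphic_f_alpha_iff:
  assumes "binary_function f"
  shows "(\<exists>g. minor_of g f \<and> isomorphic g (f_alpha \<alpha>)) \<longleftrightarrow>
    (\<exists>Y e. insert e Y \<subseteq> ground f \<and> e \<notin> Y \<and> subset_sum f Y \<noteq> 0 \<and>
       subset_sum f (insert e Y) / subset_sum f Y - 1 = \<alpha>)"
    (is "?L \<longleftrightarrow> ?R")
proof
  have fin: "finite (ground f)"
    using assms by (simp add: binary_function_def)
  have bin: "binary_function (delete (contract f X) Y)"
    if "delete_well_defined (contract f X) Y" for X Y
    using assms that by (intro binary_function_delete binary_function_contract)
  have ground: "ground (delete (contract f X) Y) = ground f - X - Y" for X Y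
    by (simp add: delete_def contract_def)
  show ?R if ?L
  proof -
    from that obtain X Y where XY: "Y \<subseteq> ground f" "X \<inter> Y = {}"
      and wd: "delete_well_defined (contract f X) Y"
      and iso: "isomorphic (delete (contract f X) Y) (f_alpha \<alpha>)"
      by (auto simp: minor_of_def)
    obtain e where e: "ground f - X - Y = {e}"
      and val: "val (delete (contract f X) Y) {e} = \<alpha>"
      using iso unfolding isomorphic_f_alpha_iff[OF bin[OF wd]] ground
      by (metis card_1_singletonE)
    have nz: "subset_sum f Y \<noteq> 0"
      using wd XY by (simp add: delete_well_defined_contract_iff)
    have "finite Y"
      using XY(1) fin by (rule finite_subset)
    then have "subset_sum f (insert e Y) / subset_sum f Y - 1 = \<alpha>"
      using val_singleton_minor[OF _ XY e nz] val by simp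
    moreover have "insert e Y \<subseteq> ground f" "e \<notin> Y"
      using e XY(1) by auto
    ultimately show ?R
      using nz by (intro exI conjI)
  qed
  show ?L if ?R
  proof -
    from that obtain Y e where Y: "insert e Y \<subseteq> ground f" "e \<notin> Y" "subset_sum f Y \<noteq> 0"
      and val: "subset_sum f (insert e Y) / subset_sum f Y - 1 = \<alpha>"
      by blast
    \<comment> \<open>Contracting all elements outside \<open>insert e Y\<close> leaves
      \<open>e\<close> alone after \<open>Y\<close> is deleted.\<close>
    define X where "X = ground f - insert e Y"
    have XY: "Y \<subseteq> ground f" "X \<inter> Y = {}" and e: "ground f - X - Y = {e}"
      using Y(1,2) by (auto simp: X_def)
    have wd: "delete_well_defined (contract f X) Y"
      using Y(3) XY by (simp add: delete_well_defined_contract_iff)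
    have "finite Y"
      using XY(1) fin by (rule finite_subset)
    then have "isomorphic (delete (contract f X) Y) (f_alpha \<alpha>)"
      using val_singleton_minor[OF _ XY e Y(3)] val
      by (simp add: isomorphic_f_alpha_iff[OF bin[OF wd]] ground e)
    moreover have "minor_of (delete (contract f X) Y) f"
      using XY wd unfolding minor_of_def X_def by blast
    ultimately show ?L
      by blast
  qed
qed

theorem theorem2:
  fixes f :: "'a set_fun"
  assumes "binary_function f"
  shows "stable_function f \<longleftrightarrow> \<not> (\<exists>g. minor_of g f \<and> isomorphic g (f_alpha (-1)))"
proof -
  have fin: "finite (ground f)"
    using assms by (simp add: binary_function_def)
  have "\<exists>Y e. insert e Y \<subseteq> ground f \<and> e \<notin> Y \<and> subset_sum f Y \<noteq> 0 \<and>
      subset_sum f (insert e Y) = 0"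
    if "W \<subseteq> ground f" "subset_sum f W = 0" for W
  proof -
    have "finite W"
      using that(1) fin by (rule finite_subset)
    then show ?thesis
      using that
    proof (induction W rule: finite_induct)
      case empty
      then show ?case
        using assms by (simp add: subset_sum_def binary_function_def)
    next
      case (insert e Y)
      then show ?case
        \<comment> \<open>If the sum already vanishes on \<open>Y\<close>, the induction hypothesis
          supplies the pair; otherwise \<open>Y\<close> and \<open>e\<close> are the pair.\<close>
        by (cases "subset_sum f Y = 0") auto
    qed
  qed
  moreover have "s / t - 1 = - 1 \<longleftrightarrow> s = 0" if "t \<noteq> 0" for s t :: real
    using that by simp
  ultimately show ?thesis
    unfolding stable_function_iff minor_isomorphic_f_alpha_iff[OF assms] by metis
qed

end
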